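(* Let $N=2^n$ be the number of elementary links of the repeater chain. For $1\le i\le n+1$, the end-to-end shared state after successfully connecting $2^{i-1}$ elementary links (defined through the recursions in the context) is $$\rho_i=\frac1{s_i}\Big[a_i|M^+\rangle\langle M^+|+b_i|M^-\rangle\langle M^-|+c_i|\psi_0\rangle\langle\psi_0|+d_i|\psi_1\rangle\langle\psi_1|+d_i|\psi_2\rangle\langle\psi_2|+c_i|\psi_3\rangle\langle\psi_3|\Big],$$ where $s_i=a_i+b_i+2(c_i+d_i)$ and the coefficients are $$a_i=\frac12\left[1+\left(\frac{a-b}{a+b}\right)^{i-1}\left(\frac{a_e-b_e}{a_e+b_e}\right)\right]z_i,\qquad b_i=\frac12\left[1-\left(\frac{a-b}{a+b}\right)^{i-1}\left(\frac{a_e-b_e}{a_e+b_e}\right)\right]z_i,$$ $$c_i=\frac{s_i}4\left[1-\frac{z_i}{s_i(1-2w_r)}\left[(1-2w_r)(1-2w_1)\right]^{2^{i-1}}\right],$$ $$d_i=\frac{s_i}4-\frac{z_i}2\left[1-\frac1{2(1-2w_r)}\left[(1-2w_r)(1-2w_1)\right]^{2^{i-1}}\right],$$ with $w_1=c_e/(a_e+b_e)$, $w_r=c/(a+b)$, $s_1=a_e+b_e+2c_e$, $s_i=s=a+b+2c$ for $2\le i\le n+1$, and $$z_i=\left(\frac{s^2}{a+b}\right)\left(\frac1{(1+2w_1)(1+2w_r)}\right)^{2^{i-1}}\quad(i\ge2),\qquad z_1=a_e+b_e.$$ For $i=1$ the expressions for $a_i,b_i,c_i,d_i$ reduce to $a_e,b_e,c_e,0$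 respectively.
   Context: Two-qubit states (dual-rail encoding): $|\psi_0\rangle=|01,01\rangle$, $|\psi_1\rangle=|01,10\rangle$, $|\psi_2\rangle=|10,01\rangle$, $|\psi_3\rangle=|10,10\rangle$ (orthonormal), $|M^\pm\rangle=(|\psi_2\rangle\pm|\psi_1\rangle)/\sqrt2$. Parameters: $\eta_r,\eta_e$ and $P_r,P_e$ are the efficiencies and dark-click probabilities of the single-photon detectors used in the Bell-state measurements at the repeater nodes (subscript $r$) and at the elementary-link centers (subscript $e$); $\lambda_m$ is the efficiency of loading/reading the memories; $\lambda=e^{-\alpha L/(2N)}$ is the transmittance of half of an elementary link, for total range $L$ and fiber loss coefficient $\alpha$. With $A_r=\eta_r\lambda_m+P_r(1-\eta_r\lambda_m)$ and $B_r=1-(1-P_r)(1-\eta_r\lambda_m)^2$, $$a=\tfrac18\left[P_r^2(1-A_r)^2+A_r^2(1-P_r)^2\right],\quad b=\tfrac18\left[2A_rP_r(1-A_r)(1-P_r)\right],\quad c=\tfrac18P_r(1-P_r)\left[P_r(1-B_r)+B_r(1-P_r)\right],$$ and $a_e,b_e,c_e$ are the same expressions with $(P_r,A_r,B_r)$ replaced by $(P_e,A_e,B_e)$, where $A_e=\eta_e\lambda+P_e(1-\eta_e\lambda)$ and $B_e=1-(1-P_e)(1-\eta_e\lambda)^2$. The state $\rho_i$ has the displayed form, where the coefficients are determined recursively by $a_1=a_e$, $b_1=b_e$, $c_1=c_e$, $d_1=0$, $s_i=a_i+b_i+2(c_i+d_i)$, and $$a_{i+1}=\frac1{s_i^2}\left[aa_i^2+(a+b)a_ib_i+bb_i^2\right],\qquad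 b_{i+1}=\frac1{s_i^2}\left[ba_i^2+(a+b)a_ib_i+ab_i^2\right],$$ $$c_{i+1}=\frac1{s_i^2}\left[c(a_i+b_i)^2+2(a+b)c_i(a_i+b_i+2d_i)+4c\left(d_i(a_i+b_i)+c_i^2+d_i^2\right)\right],$$ $$d_{i+1}=\frac1{s_i^2}\left[4cc_i(a_i+b_i+2d_i)+2(a+b)\left(d_i(a_i+b_i)+c_i^2+d_i^2\right)\right].$$ The entangled-pair sources are assumed to emit no multiple pairs. *)

theory Defs
  imports "HOL-Analysis.Analysis"
begin

section \<open>Dual-rail two-qubit states\<close>

text \<open>A basis vector is labelled by the occupation of the four optical modes (or memories), two
  for each end node, with True for one excitation and False for none.  The states live in
  the 16-dimensional space spanned by these vectors; the kets psi0, ..., psi3 span its two-qubit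
  subspace.\<close>

type_synonym modes = "(bool \<times> bool) \<times> (bool \<times> bool)"

definition ket :: "modes \<Rightarrow> complex ^ modes" where
  "ket m = axis m 1"

definition ketbra :: "complex ^ modes \<Rightarrow> complex ^ modes \<Rightarrow> complex ^ modes ^ modes" where
  "ketbra u v = (\<chi> i j. u $ i * cnj (v $ j))"

abbreviation proj :: "complex ^ modes \<Rightarrow> complex ^ modes ^ modes" where
  "proj u \<equiv> ketbra u u"

definition psi0 :: "complex ^ modes" where
  "psi0 = ket ((False, True), (False, True))"

definition psi1 :: "complex ^ modes" where
  "psi1 = ket ((False, True), (True, False))"

definition psi2 :: "complex ^ modes" where
  "psi2 = ket ((True, False), (False, True))"

definition psi3 :: "complex ^ modes" where
  "psi3 = ket ((True, False), (True, False))"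

definition M_plus :: "complex ^ modes" where
  "M_plus = (1 / sqrt 2) *\<^sub>R (psi2 + psi1)"

definition M_minus :: "complex ^ modes" where
  "M_minus = (1 / sqrt 2) *\<^sub>R (psi2 - psi1)"

section \<open>Bell-state measurement coefficients\<close>

text \<open>Here P is the dark-click probability and x the total efficiency seen by a photon: the detector
  efficiency times the memory efficiency at a repeater node, and the detector efficiency times the
  half-link transmittance at the center of an elementary link.\<close>

definition bsm_A :: "real \<Rightarrow> real \<Rightarrow> real" where
  "bsm_A P x = x + P * (1 - x)"

definition bsm_B :: "real \<Rightarrow> real \<Rightarrow> real" where
  "bsm_B P x = 1 - (1 - P) * (1 - x)\<^sup>2"

definition bsm_a :: "real \<Rightarrow> real \<Rightarrow> real" where
  "bsm_a P x = (let A = bsm_A P x in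
     1 / 8 * (P\<^sup>2 * (1 - A)\<^sup>2 + A\<^sup>2 * (1 - P)\<^sup>2))"

definition bsm_b :: "real \<Rightarrow> real \<Rightarrow> real" where
  "bsm_b P x = (let A = bsm_A P x in
     1 / 8 * (2 * A * P * (1 - A) * (1 - P)))"

definition bsm_c :: "real \<Rightarrow> real \<Rightarrow> real" where
  "bsm_c P x = (let B = bsm_B P x in
     1 / 8 * P * (1 - P) * (P * (1 - B) + B * (1 - P)))"

section \<open>The shared state of a chain of connected links\<close>

datatype coeffs = Coeffs (co_a: real) (co_b: real) (co_c: real) (co_d: real)

definition co_s :: "coeffs \<Rightarrow> real" where
  "co_s k = co_a k + co_b k + 2 * (co_c k + co_d k)"

definition connect :: "real \<Rightarrow> real \<Rightarrow> real \<Rightarrow> coeffs \<Rightarrow> coeffs" where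
  "connect a b c k =
    (let ai = co_a k; bi = co_b k; ci = co_c k; di = co_d k; si = co_s k in
     Coeffs
      (1 / si\<^sup>2 * (a * ai\<^sup>2 + (a + b) * ai * bi + b * bi\<^sup>2))
      (1 / si\<^sup>2 * (b * ai\<^sup>2 + (a + b) * ai * bi + a * bi\<^sup>2))
      (1 / si\<^sup>2 * (c * (ai + bi)\<^sup>2 + 2 * (a + b) * ci * (ai + bi + 2 * di)
                   + 4 * c * (di * (ai + bi) + ci\<^sup>2 + di\<^sup>2)))
      (1 / si\<^sup>2 * (4 * c * ci * (ai + bi + 2 * di)
                   + 2 * (a + b) * (di * (ai + bi) + ci\<^sup>2 + di\<^sup>2))))"

text \<open>Indices start at 1: index i belongs to a chain of 2^(i-1) connected elementary links.  The
  value at index 0 is meaningless.\<close>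

definition chain_coeffs ::
    "real \<Rightarrow> real \<Rightarrow> real \<Rightarrow> real \<Rightarrow> real \<Rightarrow> real \<Rightarrow> nat \<Rightarrow> coeffs" where
  "chain_coeffs a b c ae be ce i = (connect a b c ^^ (i - 1)) (Coeffs ae be ce 0)"

definition state_of :: "coeffs \<Rightarrow> complex ^ modes ^ modes" where
  "state_of k = (1 / co_s k) *\<^sub>R
     (co_a k *\<^sub>R proj M_plus + co_b k *\<^sub>R proj M_minus
      + co_c k *\<^sub>R proj psi0 + co_d k *\<^sub>R proj psi1
      + co_d k *\<^sub>R proj psi2 + co_c k *\<^sub>R proj psi3)"

end

(*
  A connection step is diagonal in the coordinates s_i, z_i = a_i + b_i, a_i - b_i and
  g_i = z_i + 2 (d_i - c_i): it sends s_i to a + b + 2 c, z_i to (a + b) z_i^2 / s_i^2,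
  a_i - b_i to (a - b) z_i (a_i - b_i) / s_i^2 and g_i to (a + b - 2 c) g_i^2 / s_i^2.
  Hence (a_i - b_i) / z_i is geometric, while (1 - 2 w_r) g_i / z_i is squared at every step, which
  gives the exponent 2^(i-1).
*)
theory Submission
  imports Defs
begin

text \<open>\<open>A\<close> and \<open>B\<close> are click probabilities, with complements
  \<open>(1 - P) * (1 - x)\<close> and \<open>(1 - P) * (1 - x)\<^sup>2\<close>. The bounds yield
  the signs of \<open>b\<close> and \<open>c\<close>, used below to keep
  \<open>a + b + 2 * c\<close> away from 0.\<close>

lemma bsm_A_bounds:
  assumes "0 \<le> P" "P \<le> 1" "0 \<le> x" "x \<le> 1"
  shows "0 \<le> bsm_A P x" "bsm_A P x \<le> 1"
proof -
  have eq: "1 - bsm_A P x = (1 - P) * (1 - x)"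
    by (simp add: bsm_A_def algebra_simps)
  show "0 \<le> bsm_A P x"
    using assms by (simp add: bsm_A_def)
  have "0 \<le> (1 - P) * (1 - x)"
    using assms by simp
  then show "bsm_A P x \<le> 1"
    using eq by linarith
qed

lemma bsm_B_bounds:
  assumes "0 \<le> P" "P \<le> 1" "0 \<le> x" "x \<le> 1"
  shows "0 \<le> bsm_B P x" "bsm_B P x \<le> 1"
  using assms by (auto simp: bsm_B_def intro!: mult_le_one power_le_one)

lemma bsm_a_nonneg: "0 \<le> bsm_a P x"
  by (simp add: bsm_a_def Let_def)

lemma bsm_b_nonneg:
  assumes "0 \<le> P" "P \<le> 1" "0 \<le> x" "x \<le> 1"
  shows "0 \<le> bsm_b P x"
  using assms bsm_A_bounds[OF assms] by (simp add: bsm_b_def Let_def)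

lemma bsm_c_nonneg:
  assumes "0 \<le> P" "P \<le> 1" "0 \<le> x" "x \<le> 1"
  shows "0 \<le> bsm_c P x"
  using assms bsm_B_bounds[OF assms] by (simp add: bsm_c_def Let_def)

definition co_z :: "coeffs \<Rightarrow> real" where
  "co_z k = co_a k + co_b k"

text \<open>Parity contrast: weight on the span of \<open>psi1\<close>, \<open>psi2\<close> minus
  weight on the span of \<open>psi0\<close>, \<open>psi3\<close>; \<open>co_s\<close> is their
  sum.\<close>

definition co_g :: "coeffs \<Rightarrow> real" where
  "co_g k = co_z k + 2 * (co_d k - co_c k)"

lemma coeffs_from_diagonal:
  "co_a k = (co_z k + (co_a k - co_b k)) / 2"
  "co_b k = (co_z k - (co_a k - co_b k)) / 2"
  "co_c k = (co_s k - co_g k) / 4"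
  "co_d k = (co_s k + co_g k - 2 * co_z k) / 4"
  by (simp_all add: co_z_def co_g_def co_s_def)

lemma co_s_connect:
  assumes "co_s k \<noteq> 0"
  shows "co_s (connect a b c k) = a + b + 2 * c"
proof -
  \<comment> \<open>Treating the reciprocal as an atom \<open>r\<close> makes the claim a polynomial
    identity; only cancelling \<open>r\<close> against the square needs \<open>co_s k\<close>
    nonzero.\<close>
  define r where "r = 1 / (co_s k)\<^sup>2"
  have "co_s (connect a b c k) = (a + b + 2 * c) * (r * (co_s k)\<^sup>2)"
    unfolding connect_def Let_def co_s_def[of "Coeffs _ _ _ _"] coeffs.sel r_def[symmetric]
    unfolding co_s_def by algebra
  then show ?thesis
    using assms by (simp add: r_def)
qed

lemma co_z_connect: "co_z (connect a b c k) = (a + b) * (co_z k)\<^sup>2 / (co_s k)\<^sup>2"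
proof -
  define r where "r = 1 / (co_s k)\<^sup>2"
  have "co_z (connect a b c k) = (a + b) * (co_z k)\<^sup>2 * r"
    unfolding connect_def Let_def co_z_def coeffs.sel r_def[symmetric] by algebra
  then show ?thesis
    by (simp add: r_def)
qed

text \<open>The cross terms cancel and \<open>ai\<^sup>2 - bi\<^sup>2\<close> contains the
  difference only once, so this coordinate grows geometrically instead of being squared.\<close>

lemma co_diff_connect:
  "co_a (connect a b c k) - co_b (connect a b c k) =
    (a - b) * (co_z k * (co_a k - co_b k)) / (co_s k)\<^sup>2"
proof -
  define r where "r = 1 / (co_s k)\<^sup>2"
  have "co_a (connect a b c k) - co_b (connect a b c k) =
      (a - b) * (co_z k * (co_a k - co_b k)) * r"
    unfolding connect_def Let_def co_z_def coeffs.sel r_def[symmetric] by algebra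
  then show ?thesis
    by (simp add: r_def)
qed

text \<open>Up to normalisation, the two parity weights are convolved over Z/2 with themselves and
  with \<open>(a + b, 2 * c)\<close>. Sums and differences of weights are then
  multiplicative.\<close>

lemma co_g_connect: "co_g (connect a b c k) = (a + b - 2 * c) * (co_g k)\<^sup>2 / (co_s k)\<^sup>2"
proof -
  define r where "r = 1 / (co_s k)\<^sup>2"
  have "co_g (connect a b c k) = (a + b - 2 * c) * (co_g k)\<^sup>2 * r"
    unfolding connect_def Let_def co_g_def co_z_def coeffs.sel r_def[symmetric] by algebra
  then show ?thesis
    by (simp add: r_def)
qed

lemma chain_coeffs_1: "chain_coeffs a b c ae be ce (Suc 0) = Coeffs ae be ce 0"
  by (simp add: chain_coeffs_def)

text \<open>The double \<open>Suc\<close> matters: truncated subtraction makes indices 0 and 1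
  coincide, so the recursion starts at 1.\<close>

lemma chain_coeffs_Suc:
  "chain_coeffs a b c ae be ce (Suc (Suc m)) = connect a b c (chain_coeffs a b c ae be ce (Suc m))"
  by (simp add: chain_coeffs_def)

locale link_chain =
  fixes a b c ae be ce :: real
  assumes t_nz: "a + b \<noteq> 0" and te_nz: "ae + be \<noteq> 0"
    and s_nz: "a + b + 2 * c \<noteq> 0" and se_nz: "ae + be + 2 * ce \<noteq> 0"
begin

abbreviation K :: "nat \<Rightarrow> coeffs" where
  "K \<equiv> chain_coeffs a b c ae be ce"

abbreviation w1 :: real where "w1 \<equiv> ce / (ae + be)"
abbreviation wr :: real where "wr \<equiv> c / (a + b)"

text \<open>A connection resets the sum to a constant; the induction hypothesis serves only to
  exclude a zero denominator.\<close>

lemma co_s_chain: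
  "co_s (K (Suc m)) = (if m = 0 then ae + be + 2 * ce else a + b + 2 * c)"
proof (induction m)
  case 0
  then show ?case
    by (simp add: chain_coeffs_1 co_s_def)
next
  case (Suc m)
  then have "co_s (K (Suc m)) \<noteq> 0"
    using s_nz se_nz by auto
  then show ?case
    by (simp add: chain_coeffs_Suc co_s_connect)
qed

text \<open>From the second index on, \<open>(a + b) * z / s\<^sup>2\<close> is squared at each
  step.\<close>

lemma co_z_chain:
  "co_z (K (Suc m)) =
    (if m = 0 then ae + be
     else (a + b + 2 * c)\<^sup>2 / (a + b) * (1 / ((1 + 2 * w1) * (1 + 2 * wr))) ^ (2 ^ m))"
proof (induction m)
  case 0
  then show ?case
    by (simp add: chain_coeffs_1 co_z_def)
next
  case (Suc m)
  show ?case
  proof (cases "m = 0")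
    case True
    \<comment> \<open>The first connection is separate because it divides by the elementary-link
      sum. Below, \<open>x\<close>, \<open>y\<close>, \<open>v\<close> are \<open>ae + be\<close>,
      that sum, and \<open>a + b + 2 * c\<close>.\<close>
    have "1 + 2 * w1 = (ae + be + 2 * ce) / (ae + be)" "1 + 2 * wr = (a + b + 2 * c) / (a + b)"
      using t_nz te_nz by (simp_all add: field_simps)
    moreover have "(a + b) * x\<^sup>2 / y\<^sup>2 = v\<^sup>2 / (a + b) * (1 / (y / x * (v / (a + b))))\<^sup>2"
      if "v \<noteq> 0" for x y v :: real
      using that t_nz by (simp add: power_divide power_mult_distrib power2_eq_square)
    ultimately show ?thesis
      using True Suc.IH s_nz by (simp add: chain_coeffs_Suc co_z_connect co_s_chain)
  next
    case False
    have "(a + b) * (v\<^sup>2 / (a + b) * r ^ (2 ^ m))\<^sup>2 / v\<^sup>2 = v\<^sup>2 / (a + b) * r ^ (2 ^ Suc m)"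
      if "v \<noteq> 0" for v r :: real
      using that t_nz by (simp add: power_mult_distrib power_divide power2_eq_square mult_2 power_add)
    then show ?thesis
      using False Suc.IH s_nz by (simp add: chain_coeffs_Suc co_z_connect co_s_chain del: power_Suc)
  qed
qed

lemma co_diff_chain:
  "co_a (K (Suc m)) - co_b (K (Suc m)) =
    ((a - b) / (a + b)) ^ m * ((ae - be) / (ae + be)) * co_z (K (Suc m))"
proof (induction m)
  case 0
  then show ?case
    using te_nz by (simp add: chain_coeffs_1 co_z_def)
next
  case (Suc m)
  have "(a - b) * (z * (p * e * z)) / y = (a - b) / (a + b) * p * e * ((a + b) * z\<^sup>2 / y)"
    for e p y z :: real
    using t_nz by (simp add: power2_eq_square)
  then show ?case
    unfolding chain_coeffs_Suc co_diff_connect co_z_connect Suc.IH power_Suc .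
qed

text \<open>The factor \<open>(co_s k)\<^sup>2\<close> is common to the updates of
  \<open>co_g\<close> and \<open>co_z\<close>, so their ratio obeys one law from the first step
  on.\<close>

lemma co_g_chain:
  assumes "1 - 2 * wr \<noteq> 0"
  shows "co_g (K (Suc m)) =
    co_z (K (Suc m)) / (1 - 2 * wr) * ((1 - 2 * wr) * (1 - 2 * w1)) ^ (2 ^ m)"
proof (induction m)
  case 0
  have "ae + be - 2 * ce = (ae + be) * (1 - 2 * w1)"
    using te_nz by (simp add: field_simps)
  moreover have "co_g (K (Suc 0)) = ae + be - 2 * ce" "co_z (K (Suc 0)) = ae + be"
    by (simp_all add: chain_coeffs_1 co_z_def co_g_def)
  moreover have "t * v = t / q * (q * v) ^ 2 ^ 0" if "q \<noteq> 0" for q t v :: real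
    using that by simp
  ultimately show ?case
    using assms by metis
next
  case (Suc m)
  have wr: "a + b - 2 * c = (a + b) * (1 - 2 * wr)"
    using t_nz by (simp add: field_simps)
  have "(a + b) * q * (z / q * x ^ 2 ^ m)\<^sup>2 / y = (a + b) * z\<^sup>2 / y / q * x ^ 2 ^ Suc m"
    if "q \<noteq> 0" for q x y z :: real
    using that by (simp add: power_mult_distrib power_divide power2_eq_square mult_2 power_add mult_ac)
  from this[OF assms] show ?case
    unfolding chain_coeffs_Suc co_g_connect co_z_connect Suc.IH wr .
qed

end

theorem mainTheorem6:
  fixes eta_r eta_e P_r P_e lambda_m alpha L lam a b c a\<^sub>e b\<^sub>e c\<^sub>e w\<^sub>1 w\<^sub>r :: real
    and n N i :: nat
    and k :: "nat \<Rightarrow> coeffs"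
    and s z a' b' c' d' :: "nat \<Rightarrow> real"
  assumes "0 \<le> eta_r" "eta_r \<le> 1" "0 \<le> eta_e" "eta_e \<le> 1"
    and "0 \<le> P_r" "P_r \<le> 1" "0 \<le> P_e" "P_e \<le> 1"
    and "0 \<le> lambda_m" "lambda_m \<le> 1"
    and "0 \<le> alpha" "0 \<le> L"
    and "N = 2 ^ n"
    and "1 \<le> i" "i \<le> n + 1"
    and "lam = exp (- alpha * L / (2 * real N))"
    and "a = bsm_a P_r (eta_r * lambda_m)"
    and "b = bsm_b P_r (eta_r * lambda_m)"
    and "c = bsm_c P_r (eta_r * lambda_m)"
    and "a\<^sub>e = bsm_a P_e (eta_e * lam)"
    and "b\<^sub>e = bsm_b P_e (eta_e * lam)"
    and "c\<^sub>e = bsm_c P_e (eta_e * lam)"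
    and "k = chain_coeffs a b c a\<^sub>e b\<^sub>e c\<^sub>e"
    and "w\<^sub>1 = c\<^sub>e / (a\<^sub>e + b\<^sub>e)"
    and "w\<^sub>r = c / (a + b)"
    and "a + b \<noteq> 0" "a\<^sub>e + b\<^sub>e \<noteq> 0" "1 - 2 * w\<^sub>r \<noteq> 0"
    and "s = (\<lambda>j. if j = 1 then a\<^sub>e + b\<^sub>e + 2 * c\<^sub>e else a + b + 2 * c)"
    and "z = (\<lambda>j. if j = 1 then a\<^sub>e + b\<^sub>e
                 else (a + b + 2 * c)\<^sup>2 / (a + b)
                      * (1 / ((1 + 2 * w\<^sub>1) * (1 + 2 * w\<^sub>r))) ^ (2 ^ (j - 1)))"
    and "a' = (\<lambda>j. 1 / 2 * (1 + ((a - b) / (a + b)) ^ (j - 1)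
                                * ((a\<^sub>e - b\<^sub>e) / (a\<^sub>e + b\<^sub>e))) * z j)"
    and "b' = (\<lambda>j. 1 / 2 * (1 - ((a - b) / (a + b)) ^ (j - 1)
                                * ((a\<^sub>e - b\<^sub>e) / (a\<^sub>e + b\<^sub>e))) * z j)"
    and "c' = (\<lambda>j. s j / 4 * (1 - z j / (s j * (1 - 2 * w\<^sub>r))
                                * ((1 - 2 * w\<^sub>r) * (1 - 2 * w\<^sub>1)) ^ (2 ^ (j - 1))))"
    and "d' = (\<lambda>j. s j / 4 - z j / 2 * (1 - 1 / (2 * (1 - 2 * w\<^sub>r))
                                * ((1 - 2 * w\<^sub>r) * (1 - 2 * w\<^sub>1)) ^ (2 ^ (j - 1))))"
  shows "state_of (k i) = (1 / s i) *\<^sub>R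
           (a' i *\<^sub>R proj M_plus + b' i *\<^sub>R proj M_minus
            + c' i *\<^sub>R proj psi0 + d' i *\<^sub>R proj psi1
            + d' i *\<^sub>R proj psi2 + c' i *\<^sub>R proj psi3)
       \<and> co_s (k i) = s i
       \<and> co_a (k i) = a' i \<and> co_b (k i) = b' i \<and> co_c (k i) = c' i \<and> co_d (k i) = d' i
       \<and> s i = a' i + b' i + 2 * (c' i + d' i)
       \<and> a' 1 = a\<^sub>e \<and> b' 1 = b\<^sub>e \<and> c' 1 = c\<^sub>e \<and> d' 1 = 0"
proof -
  obtain m where i: "i = Suc m"
    using \<open>1 \<le> i\<close> by (cases i) auto
  have x_r: "0 \<le> eta_r * lambda_m" "eta_r * lambda_m \<le> 1"
    using assms(1,2,9,10) by (auto intro: mult_le_one)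
  have "0 \<le> lam" "lam \<le> 1"
    using assms(11,12,16) by auto
  then have x_e: "0 \<le> eta_e * lam" "eta_e * lam \<le> 1"
    using assms(3,4) by (auto intro: mult_le_one)
  \<comment> \<open>Nonnegativity turns \<open>a + b \<noteq> 0\<close> into
    \<open>a + b > 0\<close>, whence \<open>a + b + 2 * c > 0\<close>; likewise for the elementary
    link.\<close>
  have "0 \<le> a" "0 \<le> b" "0 \<le> c"
    using assms(5,6,17-19) x_r bsm_a_nonneg bsm_b_nonneg bsm_c_nonneg by auto
  moreover have "0 \<le> a\<^sub>e" "0 \<le> b\<^sub>e" "0 \<le> c\<^sub>e"
    using assms(7,8,20-22) x_e bsm_a_nonneg bsm_b_nonneg bsm_c_nonneg by auto
  ultimately interpret link_chain a b c a\<^sub>e b\<^sub>e c\<^sub>e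
    using \<open>a + b \<noteq> 0\<close> \<open>a\<^sub>e + b\<^sub>e \<noteq> 0\<close> by unfold_locales auto
  have k: "k = K" and wr: "1 - 2 * wr \<noteq> 0"
    using assms(23,25,28) by auto
  have s: "co_s (k (Suc j)) = s (Suc j)" and z: "co_z (k (Suc j)) = z (Suc j)" for j
    unfolding k co_s_chain co_z_chain assms(24,25,29,30) by auto
  have diff: "co_a (k (Suc j)) - co_b (k (Suc j)) =
      ((a - b) / (a + b)) ^ j * ((a\<^sub>e - b\<^sub>e) / (a\<^sub>e + b\<^sub>e)) * z (Suc j)" for j
    using co_diff_chain[of j] z[of j] k by simp
  have g: "co_g (k (Suc j)) =
      z (Suc j) / (1 - 2 * w\<^sub>r) * ((1 - 2 * w\<^sub>r) * (1 - 2 * w\<^sub>1)) ^ (2 ^ j)" for j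
    using co_g_chain[OF wr, of j] z[of j] k assms(24,25) by simp
  have s_nz: "s (Suc j) \<noteq> 0" for j
    using s_nz se_nz assms(29) by simp
  have coeffs: "co_a (k (Suc j)) = a' (Suc j)" "co_b (k (Suc j)) = b' (Suc j)"
      "co_c (k (Suc j)) = c' (Suc j)" "co_d (k (Suc j)) = d' (Suc j)" for j
  proof -
    have "(Z + X * Z) / 2 = 1 / 2 * (1 + X) * Z" for X Z :: real
      by (simp add: algebra_simps)
    then show "co_a (k (Suc j)) = a' (Suc j)"
      by (subst coeffs_from_diagonal(1)) (simp only: z diff assms(31) diff_Suc_1)
    have "(Z - X * Z) / 2 = 1 / 2 * (1 - X) * Z" for X Z :: real
      by (simp add: algebra_simps)
    then show "co_b (k (Suc j)) = b' (Suc j)"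
      by (subst coeffs_from_diagonal(2)) (simp only: z diff assms(32) diff_Suc_1)
    \<comment> \<open>The closed form of \<open>c'\<close> has \<open>s\<close> factored out of the
      bracket, hence the division by \<open>S\<close>.\<close>
    have c_form: "(S - Z / q * X) / 4 = S / 4 * (1 - Z / (S * q) * X)" if "S \<noteq> 0" for S Z q X :: real
      using that by (simp add: right_diff_distrib diff_divide_distrib)
    show "co_c (k (Suc j)) = c' (Suc j)"
      by (subst coeffs_from_diagonal) (simp only: s g c_form[OF s_nz] assms(33) diff_Suc_1)
    have d_form: "(S + Z / q * X - 2 * Z) / 4 = S / 4 - Z / 2 * (1 - 1 / (2 * q) * X)"
      for S Z q X :: real
      by (simp add: algebra_simps add_divide_distrib diff_divide_distrib)
    show "co_d (k (Suc j)) = d' (Suc j)"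
      by (subst coeffs_from_diagonal) (simp only: s g z d_form assms(34) diff_Suc_1)
  qed
  \<comment> \<open>The reduction at index 1 is the instance \<open>j = 0\<close>, read against the
    initial coefficients.\<close>
  have "a' 1 = a\<^sub>e" "b' 1 = b\<^sub>e" "c' 1 = c\<^sub>e" "d' 1 = 0"
    using coeffs[of 0] k chain_coeffs_1 by auto
  moreover have "s i = a' i + b' i + 2 * (c' i + d' i)"
    using s[of m] coeffs[of m] by (simp add: i co_s_def)
  ultimately show ?thesis
    using s[of m] coeffs[of m] by (simp add: i state_of_def)
qed

end
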